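(* Let $0<s<1$. For $m=(m_1,m_2)\in\mathbb{Z}^2\setminus\{(0,0)\}$ let $$K_s(m)=\frac{1}{|\Gamma(-s)|}\int_0^\infty e^{-4t}I_{m_1}(2t)I_{m_2}(2t)\,\frac{dt}{t^{1+s}}.$$ Then, when both $m_1\to\pm\infty$ and $m_2\to\pm\infty$, $$0<K_s(m)=\frac{c_{2,s}}{\|m\|_2^{2+2s}}+o\big(\|m\|_2^{-(2+2s)}\big),\qquad\text{where } c_{2,s}=\frac{4^s\Gamma(1+s)}{\pi|\Gamma(-s)|};$$ that is, $K_s(m)>0$ whenever $\min\{|m_1|,|m_2|\}$ is large enough, and $\|m\|_2^{2+2s}K_s(m)\to c_{2,s}$ as $\min\{|m_1|,|m_2|\}\to\infty$.
   Context: $I_k$ denotes the modified Bessel function of the first kind of order $k\in\mathbb{Z}$, and $\|m\|_2=(|m_1|^2+|m_2|^2)^{1/2}$. $K_s$ is the kernel of the fractional power $(-\Delta_1)^s$ of the discrete Laplacian on $\mathbb{Z}^2$, whose heat kernel is $G(m,t)=e^{-4t}I_{m_1}(2t)I_{m_2}(2t)$. *)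

theory Defs
  imports "HOL-Analysis.Analysis" "HOL-Library.Landau_Symbols"
begin

text \<open>
  Modified Bessel function of the first kind, by its usual power series. The terms use the
  reciprocal Gamma function \<^const>\<open>rGamma\<close>, which is total and vanishes at the nonpositive
  integers; hence for negative order the terms with $n + k < 0$ are $0$, as in the usual
  convention.
\<close>

definition bessel_I :: "int \<Rightarrow> real \<Rightarrow> real" where
  "bessel_I k x = (\<Sum>n. rGamma (of_int (int n + k + 1)) / fact n * (x / 2) powi (2 * int n + k))"

definition heat_kernel :: "int \<times> int \<Rightarrow> real \<Rightarrow> real" where
  "heat_kernel m t = exp (- 4 * t) * bessel_I (fst m) (2 * t) * bessel_I (snd m) (2 * t)"

text \<open>
  A Lebesgue integral. At \<open>m = (0, 0)\<close> it diverges, and the value there is the meaningless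
  default $0$.
\<close>

definition K :: "real \<Rightarrow> int \<times> int \<Rightarrow> real" where
  "K s m = 1 / \<bar>Gamma (- s)\<bar> * (LBINT t:{0<..}. heat_kernel m t / t powr (1 + s))"

definition norm2 :: "int \<times> int \<Rightarrow> real" where
  "norm2 m = sqrt (real_of_int \<bar>fst m\<bar> ^ 2 + real_of_int \<bar>snd m\<bar> ^ 2)"

definition c2 :: "real \<Rightarrow> real" where
  "c2 s = 4 powr s * Gamma (1 + s) / (pi * \<bar>Gamma (- s)\<bar>)"

text \<open>The filter on \<open>\<int>\<^sup>2\<close> expressing $\min\{|m_1|, |m_2|\} \to \infty$.\<close>

definition both_at_infinity :: "(int \<times> int) filter" where
  "both_at_infinity = filtercomap (\<lambda>m. min \<bar>fst m\<bar> \<bar>snd m\<bar>) at_top"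

end

theory Submission
  imports Defs "HOL-Probability.Characteristic_Functions" "HOL-Real_Asymp.Real_Asymp"
begin

text \<open>
  Write $N = \|m\|_2$ and substitute $t = N^2 u$ in the integral that defines $K_s(m)$:
  \[ N^{2+2s} K_s(m) = \frac{1}{|\Gamma(-s)|} \int_0^\infty N^2\, G(m, N^2 u)\, \frac{du}{u^{1+s}}. \]
  Under this parabolic scaling the lattice heat kernel approaches the heat kernel of the plane,
  $N^2 G(m, N^2 u) \to e^{-1/(4u)} / (4\pi u)$, and integrating the limit against $u^{-1-s}$ gives
  $4^s \Gamma(1+s) / \pi$. The theorem is therefore an application of dominated convergence.

  Both ingredients come from one integral representation (\<open>bessel_I_integral_rep\<close>): $r^k I_k(x)$ is the
  $k$-th Fourier coefficient of the generating function $e^{(x/2)(z + 1/z)}$ on the circle $|z| = r$.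

  With $r = 1$, the rescaled Fourier transform $e^{-x(1 - \cos(\varphi/\sqrt x))}$ tends to
  $e^{-\varphi^2/2}$ in $L^1$. Hence $\sqrt{x}\, e^{-x} I_k(x)$ is uniformly in $k$ close to the Gaussian
  $e^{-k^2/(2x)} / \sqrt{2\pi}$ as $x \to \infty$ (\<open>local_limit\<close>, \<open>local_limit_error_tendsto\<close>), which
  gives the pointwise limit (\<open>heat_kernel_rescaled_limit\<close>).

  For the majorant, $r = 1$ yields $\sqrt{x}\, e^{-x} I_k(x) \le 1$ and thus $N^2 G(m, N^2 u) \le 1/u$,
  which suffices for large $u$. For small $u$ one needs a power of $u$ greater than $s$. The choice
  $r = 1 + |k|/x$ yields $\sqrt{x}\, e^{-x} I_k(x) \le 16 x^2 / k^4$ for $k \ge 4$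
  (\<open>scaled_bessel_le_power4\<close>, where negative orders use $1/r$); applied to the larger coordinate it
  gives $N^2 G(m, N^2 u) \le 128\, u$ for $N \ge 6$, and $u \cdot u^{-1-s}$ is integrable
  at $0$ since $s < 1$.
\<close>

section \<open>Fourier series on the circle and the Bessel functions\<close>

text \<open>
  As a finite measure space, the period interval makes every bounded measurable function integrable.
\<close>

definition circle_measure :: "real measure" where
  "circle_measure = restrict_space lborel {-pi..pi}"

lemma space_circle_measure [simp]: "space circle_measure = {-pi..pi}"
  by (simp add: circle_measure_def space_restrict_space)

lemma integral_circle_measure:
  fixes f :: "real \<Rightarrow> 'a :: {banach, second_countable_topology}"
  shows "integral\<^sup>L circle_measure f = (LBINT \<theta>:{-pi..pi}. f \<theta>)"
  by (simp add: circle_measure_def integral_restrict_space set_lebesgue_integral_def)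

interpretation circle: finite_measure circle_measure
  by (rule finite_measureI) (simp add: circle_measure_def emeasure_restrict_space space_restrict_space)

lemma integral_circle_const: "integral\<^sup>L circle_measure (\<lambda>_. c :: complex) = 2 * pi * c"
  by (simp add: circle_measure_def measure_restrict_space space_restrict_space scaleR_conv_of_real)

lemma integrable_circle:
  fixes f :: "real \<Rightarrow> 'a :: {banach, second_countable_topology}"
  assumes "continuous_on UNIV f"
  shows "integrable circle_measure f"
proof -
  have "integrable lborel (\<lambda>x. indicator {-pi..pi} x *\<^sub>R f x)"
    by (rule borel_integrable_compact) (use assms in \<open>auto intro: continuous_on_subset\<close>)
  thus ?thesis by (simp add: circle_measure_def integrable_restrict_space)
qed

lemma integral_circle_cis:
  fixes j :: int
  shows "(LINT \<theta>|circle_measure. cis (of_int j * \<theta>)) = (if j = 0 then 2 * pi else 0)"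
proof (cases "j = 0")
  case True
  thus ?thesis using integral_circle_const[of 1] by simp
next
  case False
  define F where "F = (\<lambda>\<theta>::real. cis (of_int j * \<theta>) / (\<i> * of_int j))"
  have "(LINT \<theta>|circle_measure. cis (of_int j * \<theta>)) = F pi - F (-pi)"
    unfolding integral_circle_measure set_lebesgue_integral_def
  proof (rule integral_FTC_Icc)
    fix x :: real
    have "((\<lambda>z. exp (\<i> * of_int j * z) / (\<i> * of_int j)) has_field_derivative
             exp (\<i> * of_int j * of_real x)) (at (of_real x))"
      using False by (auto intro!: derivative_eq_intros)
    from has_vector_derivative_real_field[OF this]
    show "(F has_vector_derivative cis (of_int j * x)) (at x within {-pi..pi})"
      by (simp add: F_def cis_conv_exp mult.assoc)
  qed (auto intro!: continuous_intros)
  also have "F pi = F (-pi)"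
  proof -
    have "cis (of_int j * pi) = cis (- (of_int j * pi)) * cis (2 * pi * of_int j)"
      by (simp add: cis_mult algebra_simps)
    thus ?thesis by (simp add: F_def cis_multiple_2pi)
  qed
  finally show ?thesis using False by simp
qed

text \<open>
  The exponential series converges uniformly on the circle, so it may be integrated term by term.
  The Bessel series comes out of two applications, one for each of the two exponentials in the
  generating function.
\<close>

lemma integral_circle_times_exp:
  fixes h w :: "real \<Rightarrow> complex"
  assumes h: "continuous_on UNIV h" and w: "continuous_on UNIV w"
    and W: "\<And>\<theta>. norm (w \<theta>) \<le> W" and H: "\<And>\<theta>. norm (h \<theta>) \<le> H"
  shows "(\<lambda>n. (LINT \<theta>|circle_measure. h \<theta> * w \<theta> ^ n) / fact n) sums
           (LINT \<theta>|circle_measure. h \<theta> * exp (w \<theta>))"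
proof -
  have "(\<lambda>n. (LINT \<theta>|circle_measure. h \<theta> * w \<theta> ^ n / fact n)) sums
           (LINT \<theta>|circle_measure. (\<Sum>n. h \<theta> * w \<theta> ^ n / fact n))"
  proof (rule sums_integral)
    show int: "integrable circle_measure (\<lambda>\<theta>. h \<theta> * w \<theta> ^ n / fact n)" for n
      by (intro integrable_circle continuous_intros h w) auto
    show "AE \<theta> in circle_measure. summable (\<lambda>n. norm (h \<theta> * w \<theta> ^ n / fact n))"
    proof (rule AE_I2)
      fix \<theta> show "summable (\<lambda>n. norm (h \<theta> * w \<theta> ^ n / fact n))"
        using summable_mult[OF summable_norm_exp[of "w \<theta>"], of "norm (h \<theta>)"]
        by (simp add: norm_mult norm_divide norm_power field_simps)
    qed
    show "summable (\<lambda>n. LINT \<theta>|circle_measure. norm (h \<theta> * w \<theta> ^ n / fact n))"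
    proof (rule summable_comparison_test)
      have H0: "H \<ge> 0" using H[of 0] norm_ge_zero order_trans by blast
      show "\<exists>N. \<forall>n\<ge>N. norm (LINT \<theta>|circle_measure. norm (h \<theta> * w \<theta> ^ n / fact n))
               \<le> measure circle_measure {-pi..pi} * H * (W ^ n / fact n)"
      proof (intro exI[of _ 0] allI impI)
        fix n :: nat
        have "norm (LINT \<theta>|circle_measure. norm (h \<theta> * w \<theta> ^ n / fact n))
               = (LINT \<theta>|circle_measure. norm (h \<theta> * w \<theta> ^ n / fact n))"
          by (simp add: integral_nonneg_AE)
        also have "\<dots> \<le> (LINT \<theta>|circle_measure. H * (W ^ n / fact n))"
        proof (rule integral_mono)
          show "integrable circle_measure (\<lambda>\<theta>. norm (h \<theta> * w \<theta> ^ n / fact n))"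
            using int by (rule integrable_norm)
          show "norm (h x * w x ^ n / fact n) \<le> H * (W ^ n / fact n)" for x
            unfolding norm_mult norm_divide norm_power times_divide_eq_right norm_fact
            by (intro divide_right_mono mult_mono power_mono W H H0) auto
        qed auto
        also have "\<dots> = measure circle_measure {-pi..pi} * H * (W ^ n / fact n)"
          by simp
        finally show "norm (LINT \<theta>|circle_measure. norm (h \<theta> * w \<theta> ^ n / fact n))
               \<le> measure circle_measure {-pi..pi} * H * (W ^ n / fact n)" .
      qed
      show "summable (\<lambda>n. measure circle_measure {-pi..pi} * H * (W ^ n / fact n))"
        using summable_exp[of W] by (intro summable_mult) (simp add: field_simps)
    qed
  qed
  also have "(\<lambda>\<theta>. \<Sum>n. h \<theta> * w \<theta> ^ n / fact n) = (\<lambda>\<theta>. h \<theta> * exp (w \<theta>))"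
  proof
    fix \<theta>
    have "(\<lambda>n. h \<theta> * (w \<theta> ^ n /\<^sub>R fact n)) sums (h \<theta> * exp (w \<theta>))"
      by (intro sums_mult exp_converges)
    thus "(\<Sum>n. h \<theta> * w \<theta> ^ n / fact n) = h \<theta> * exp (w \<theta>)"
      by (simp add: sums_iff scaleR_conv_of_real field_simps)
  qed
  finally show ?thesis by simp
qed

text \<open>
  Orthogonality leaves the single term $n = j$ of the series of the exponential. The reciprocal
  Gamma function vanishes at the nonpositive integers, which makes the formula correct also for
  $j < 0$, where no term is left. Hence all integer orders can be treated alike below.
\<close>

lemma integral_circle_exp_cis:
  fixes a :: real and j :: int
  assumes "a > 0"
  shows "(LINT \<theta>|circle_measure. cis (- of_int j * \<theta>) * exp (a * cis \<theta>))
           = 2 * pi * complex_of_real (a powi j * rGamma (of_int (j + 1)))"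
proof -
  have "(\<lambda>n. (LINT \<theta>|circle_measure. cis (- of_int j * \<theta>) * (a * cis \<theta>) ^ n) / fact n) sums
          (LINT \<theta>|circle_measure. cis (- of_int j * \<theta>) * exp (a * cis \<theta>))"
    by (rule integral_circle_times_exp[where W = a and H = 1])
       (use assms in \<open>auto intro!: continuous_intros simp: norm_mult\<close>)
  moreover have "(LINT \<theta>|circle_measure. cis (- of_int j * \<theta>) * (a * cis \<theta>) ^ n)
                  = (if int n = j then 2 * pi * a ^ n else 0)" for n
  proof -
    have "(\<lambda>\<theta>. cis (- of_int j * \<theta>) * (a * cis \<theta>) ^ n)
            = (\<lambda>\<theta>. of_real (a ^ n) * cis (of_int (int n - j) * \<theta>))"
      by (rule ext) (simp add: power_mult_distrib Complex.DeMoivre cis_mult algebra_simps)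
    thus ?thesis using integral_circle_cis[of "int n - j"] by simp
  qed
  ultimately have sm: "(\<lambda>n. (if int n = j then 2 * pi * a ^ n else 0) / fact n) sums
      (LINT \<theta>|circle_measure. cis (- of_int j * \<theta>) * exp (a * cis \<theta>))" (is "?f sums ?I")
    by simp
  show ?thesis
  proof (cases "j \<ge> 0")
    case True
    then obtain N where j: "j = int N" using nonneg_int_cases by blast
    have "?f sums (?f N)"
      using sums_single[of N ?f] by (rule sums_cong[THEN iffD1, rotated]) (auto simp: j)
    hence "?I = ?f N" using sm sums_unique2 by blast
    moreover have "rGamma (of_int (j + 1)) = inverse (fact N :: real)"
      using Gamma_fact[of N, where 'a = real] by (simp add: j rGamma_inverse_Gamma add.commute)
    ultimately have "?I = of_real (2 * pi * a ^ N) * of_real (rGamma (of_int (j + 1)))"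
      by (simp add: j divide_inverse)
    thus ?thesis by (simp add: j)
  next
    case False
    hence "?f = (\<lambda>_. 0)" by (auto simp: fun_eq_iff)
    hence "?I = 0" using sm by (metis sums_0 sums_unique2)
    moreover have "rGamma (of_int (j + 1) :: real) = 0"
      using False by (subst rGamma_eq_zero_iff) (auto simp: nonpos_Ints_def simp del: of_int_add)
    ultimately show ?thesis by simp
  qed
qed

text \<open>
  The generating function $e^{(x/2)(z + 1/z)} = \sum_k I_k(x) z^k$ read off on the circle of
  radius $r$: its $k$-th Fourier coefficient there is $r^k I_k(x)$. The free radius replaces a
  shift of the contour of integration, and choosing it well yields the decay of $I_k(x)$ in $k$.
\<close>

lemma bessel_I_integral_rep:
  fixes x r :: real and k :: int
  assumes x: "x > 0" and r: "r > 0"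
  shows "(LINT \<theta>|circle_measure. cis (- of_int k * \<theta>) *
            exp (x / 2 * (r * cis \<theta> + cis (- \<theta>) / r)))
          = 2 * pi * complex_of_real (r powi k * bessel_I k x)"
proof -
  define a b where "a = x / 2 * r" and "b = x / 2 / r"
  have ab: "a > 0" "b > 0" using x r by (auto simp: a_def b_def)
  define h where "h = (\<lambda>\<theta>. cis (- of_int k * \<theta>) * exp (a * cis \<theta>))"
  have "(\<lambda>n. (LINT \<theta>|circle_measure. h \<theta> * (b * cis (-\<theta>)) ^ n) / fact n) sums
          (LINT \<theta>|circle_measure. h \<theta> * exp (b * cis (-\<theta>)))"
    by (rule integral_circle_times_exp[where W = b and H = "exp a"])
       (use ab in \<open>auto intro!: continuous_intros mult_left_le cos_le_one simp: h_def norm_mult\<close>)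
  moreover have "(LINT \<theta>|circle_measure. h \<theta> * (b * cis (-\<theta>)) ^ n) / fact n =
     of_real (2 * pi * r powi k * (rGamma (of_int (int n + k + 1)) / fact n * (x / 2) powi (2 * int n + k)))"
    for n
  proof -
    have "(\<lambda>\<theta>. h \<theta> * (b * cis (-\<theta>)) ^ n)
            = (\<lambda>\<theta>. of_real (b ^ n) * (cis (- of_int (int n + k) * \<theta>) * exp (a * cis \<theta>)))"
      by (rule ext) (simp add: h_def power_mult_distrib Complex.DeMoivre cis_mult algebra_simps)
    hence "(LINT \<theta>|circle_measure. h \<theta> * (b * cis (-\<theta>)) ^ n) / fact n =
       of_real (b ^ n) * (2 * pi * complex_of_real (a powi (int n + k) * rGamma (of_int (int n + k + 1)))) / fact n"
      using integral_circle_exp_cis[OF ab(1), of "int n + k"] by simp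
    also have "\<dots> = of_real (2 * pi * (b ^ n * a powi (int n + k)) * rGamma (of_int (int n + k + 1)) / fact n)"
      by simp
    also have "b ^ n * a powi (int n + k) = r powi k * (x / 2) powi (2 * int n + k)"
    proof -
      have "a powi (int n + k) = (x/2) powi (int n + k) * (r ^ n * r powi k)"
        using x r power_int_mult_distrib[of "x/2" r "int n + k"] power_int_add[of r "int n" k] by (simp add: a_def)
      moreover have "b ^ n = (x/2) ^ n / r ^ n" by (simp add: b_def power_divide)
      moreover have "(x/2) powi (2 * int n + k) = (x/2) ^ n * (x/2) powi (int n + k)"
        using x power_int_add[of "x/2" "int n" "int n + k"] by (simp add: algebra_simps)
      ultimately show ?thesis using r by simp
    qed
    finally show ?thesis by (simp add: mult_ac)
  qed
  ultimately have I: "(\<lambda>n. of_real (2 * pi * r powi k * (rGamma (of_int (int n + k + 1)) / fact n * (x / 2) powi (2 * int n + k))))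
     sums (LINT \<theta>|circle_measure. h \<theta> * exp (b * cis (-\<theta>)))" (is "(\<lambda>n. complex_of_real (?c * ?t n)) sums ?I") by simp
  \<comment> \<open>\<open>suminf\<close> has a value even for divergent series; convergence of the Bessel series is read off from the integral.\<close>
  have "(\<lambda>n. ?c * ?t n) sums Re ?I"
    using sums_Re[OF I] by (simp only: Re_complex_of_real)
  from sums_summable[OF this] have "summable ?t"
    using r by (simp only: summable_cmult_iff) simp
  hence J: "(\<lambda>n. complex_of_real (?c * ?t n)) sums of_real (?c * bessel_I k x)"
    unfolding bessel_I_def by (intro sums_of_real sums_mult summable_sums)
  from sums_unique2[OF I J] have "?I = of_real (2 * pi * r powi k * bessel_I k x)" .
  moreover have "h \<theta> * exp (b * cis (-\<theta>)) =
      cis (- of_int k * \<theta>) * exp (x / 2 * (r * cis \<theta> + cis (- \<theta>) / r))" for \<theta>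
    by (simp add: h_def mult.assoc flip: exp_add)
       (simp add: a_def b_def algebra_simps add_divide_distrib)
  ultimately show ?thesis by (simp add: mult.assoc)
qed

section \<open>Uniform bounds for the Bessel functions\<close>

text \<open>
  Taylor's formula gives $1 - \cos\varphi \ge \varphi^2 / 2 - \varphi^4 / 24$, and
  $\varphi^2 \le \pi^2 < 10$. The point is that the bound is quadratic on the whole period, so that
  $e^{-x(1 - \cos\varphi)}$ is dominated by a Gaussian.
\<close>

lemma one_minus_cos_ge:
  assumes "\<bar>\<phi>\<bar> \<le> pi"
  shows "\<phi>\<^sup>2 / 12 \<le> 1 - cos \<phi>"
proof -
  obtain t where t: "cos \<phi> = (\<Sum>m<4. cos_coeff m * \<phi> ^ m) + cos (t + 1/2 * real 4 * pi) / fact 4 * \<phi> ^ 4"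
    using Maclaurin_cos_expansion[of \<phi> 4] by blast
  have "cos (t + 1/2 * real 4 * pi) / fact 4 * \<phi> ^ 4 \<le> 1 / 24 * \<phi> ^ 4"
    by (rule mult_right_mono) (auto simp: fact_numeral)
  also have "\<phi> ^ 4 = \<phi>\<^sup>2 * \<phi>\<^sup>2" by (simp flip: power_add)
  also have "1 / 24 * (\<phi>\<^sup>2 * \<phi>\<^sup>2) \<le> 1 / 24 * (\<phi>\<^sup>2 * 10)"
  proof -
    have "\<phi>\<^sup>2 \<le> pi\<^sup>2" using assms by (metis abs_ge_zero power2_abs power_mono)
    also have "\<dots> \<le> 3.15\<^sup>2" using pi_approx by (intro power_mono) auto
    finally show ?thesis by (intro mult_left_mono) (auto simp: power2_eq_square)
  qed
  finally have "cos (t + 1/2 * real 4 * pi) / fact 4 * \<phi> ^ 4 \<le> \<phi>\<^sup>2 * 10 / 24" by simp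
  moreover have "(\<Sum>m<4. cos_coeff m * \<phi> ^ m) = 1 - \<phi>\<^sup>2 / 2"
    by (simp add: eval_nat_numeral cos_coeff_Suc sin_coeff_Suc)
  ultimately show ?thesis using t by simp
qed

lemma gaussian_integral:
  fixes a :: real
  assumes "a > 0"
  shows "integrable lborel (\<lambda>\<theta>. exp (- (a * \<theta>\<^sup>2)))"
    and "(LBINT \<theta>. exp (- (a * \<theta>\<^sup>2))) = sqrt (pi / a)"
proof -
  define \<sigma> where "\<sigma> = sqrt (1 / (2 * a))"
  have \<sigma>: "\<sigma> > 0" "2 * \<sigma>\<^sup>2 = 1 / a" using assms by (auto simp: \<sigma>_def)
  have eq: "exp (- (a * \<theta>\<^sup>2)) = sqrt (pi / a) * normal_density 0 \<sigma> \<theta>" for \<theta>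
  proof -
    have "2 * pi * \<sigma>\<^sup>2 = pi / a" "\<theta>\<^sup>2 / (2 * \<sigma>\<^sup>2) = a * \<theta>\<^sup>2" 
      using \<sigma> assms by (auto simp: field_simps)
    thus ?thesis using assms by (simp add: normal_density_def)
  qed
  show "integrable lborel (\<lambda>\<theta>. exp (- (a * \<theta>\<^sup>2)))"
    unfolding eq using \<sigma> by simp
  show "(LBINT \<theta>. exp (- (a * \<theta>\<^sup>2))) = sqrt (pi / a)"
    unfolding eq using \<sigma> by simp
qed

text \<open>
  The normalisation $\sqrt{x}\, e^{-x} I_k(x)$ is the one that has a limit as $x \to \infty$ with
  $k / \sqrt{x}$ fixed.
\<close>

definition scaled_bessel :: "int \<Rightarrow> real \<Rightarrow> real" where
  "scaled_bessel k x = sqrt x * exp (- x) * bessel_I k x"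

text \<open>
  On the circle of radius $r$ the modulus of the generating function is $e^{X\cos\theta}$ with
  $X = x(r + 1/r)/2 \ge x$. The factor $e^{-X(1 - \cos\theta)}$ integrates to $O(x^{-1/2})$
  uniformly in $r$, which pays for the factor $\sqrt{x}$; what remains is $e^{X - x}$.
\<close>

lemma scaled_bessel_le:
  fixes x r :: real and k :: int
  assumes x: "x > 0" and r: "r > 0"
  shows "r powi k * \<bar>scaled_bessel k x\<bar> \<le> exp (x * ((r + 1 / r) / 2 - 1))"
proof -
  define X where "X = x * ((r + 1 / r) / 2)"
  have "r + 1 / r \<ge> 2"
  proof -
    have "(r - 1)\<^sup>2 / r \<ge> 0" using r by simp
    also have "(r - 1)\<^sup>2 / r = r + 1 / r - 2" using r by (simp add: power2_eq_square field_simps)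
    finally show ?thesis by simp
  qed
  hence Xx: "X \<ge> x" using x by (simp add: X_def)
  have "2 * pi * (r powi k * \<bar>bessel_I k x\<bar>)
         = norm (LINT \<theta>|circle_measure. cis (- of_int k * \<theta>) *
              exp (x / 2 * (r * cis \<theta> + cis (- \<theta>) / r)))"
    unfolding bessel_I_integral_rep[OF assms] norm_mult norm_of_real using r by (simp add: abs_mult)
  also have "\<dots> \<le> (LINT \<theta>|circle_measure. norm (cis (- of_int k * \<theta>) *
              exp (x / 2 * (r * cis \<theta> + cis (- \<theta>) / r))))"
    by (rule integral_norm_bound)
  also have "\<dots> = (LINT \<theta>|circle_measure. exp (X * cos \<theta>))"
    by (intro Bochner_Integration.integral_cong)
       (auto simp: norm_mult X_def field_simps)
  also have "\<dots> = (LBINT \<theta>. indicator {-pi..pi} \<theta> * exp (X * cos \<theta>))"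
    by (simp add: integral_circle_measure set_lebesgue_integral_def)
  also have "\<dots> \<le> (LBINT \<theta>. exp X * exp (- (x / 12 * \<theta>\<^sup>2)))"
  proof (rule integral_mono)
    have "integrable circle_measure (\<lambda>\<theta>. exp (X * cos \<theta>))"
      by (intro integrable_circle continuous_intros)
    thus "integrable lborel (\<lambda>\<theta>. indicator {-pi..pi} \<theta> * exp (X * cos \<theta>))"
      by (simp add: circle_measure_def integrable_restrict_space)
    show "integrable lborel (\<lambda>\<theta>. exp X * exp (- (x / 12 * \<theta>\<^sup>2)))"
      using gaussian_integral(1)[of "x/12"] x by simp
    fix \<theta> :: real
    show "indicator {-pi..pi} \<theta> * exp (X * cos \<theta>) \<le> exp X * exp (- (x / 12 * \<theta>\<^sup>2))"
    proof (cases "\<bar>\<theta>\<bar> \<le> pi")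
      case True
      have "x * (\<theta>\<^sup>2 / 12) \<le> X * (1 - cos \<theta>)"
        using one_minus_cos_ge[OF True] Xx x by (intro mult_mono) auto
      thus ?thesis by (auto simp: algebra_simps simp flip: exp_add split: split_indicator)
    qed (auto split: split_indicator)
  qed
  also have "\<dots> = exp X * sqrt (12 * pi / x)"
    using gaussian_integral(2)[of "x/12"] x by (simp add: mult_ac)
  finally have "2 * pi * (r powi k * \<bar>bessel_I k x\<bar>) \<le> exp X * sqrt (12 * pi / x)" .
  hence "sqrt x * exp (-x) * (2 * pi * (r powi k * \<bar>bessel_I k x\<bar>))
           \<le> sqrt x * exp (-x) * (exp X * sqrt (12 * pi / x))"
    using x by (intro mult_left_mono) auto
  also have "\<dots> = exp (X - x) * sqrt (12 * pi)"
    using x by (simp add: real_sqrt_divide exp_diff exp_minus field_simps)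
  also have "\<dots> \<le> exp (X - x) * (2 * pi)"
  proof (rule mult_left_mono)
    have "12 * pi \<le> (2 * pi)\<^sup>2" using pi_gt3 by (simp add: power2_eq_square)
    thus "sqrt (12 * pi) \<le> 2 * pi" by (intro real_le_lsqrt) auto
  qed auto
  also have "X - x = x * ((r + 1 / r) / 2 - 1)" by (simp add: X_def algebra_simps)
  finally have "(2 * pi) * (r powi k * \<bar>scaled_bessel k x\<bar>) \<le> (2 * pi) * exp (x * ((r + 1 / r) / 2 - 1))"
    using x by (simp add: scaled_bessel_def abs_mult mult_ac)
  thus ?thesis by simp
qed

lemma scaled_bessel_le_1:
  assumes "x > 0"
  shows "\<bar>scaled_bessel k x\<bar> \<le> 1"
  using scaled_bessel_le[OF assms, of 1 k] by simp

text \<open>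
  The radius $\rho = 1 + |k|/x$ makes the exponent $x((\rho + 1/\rho)/2 - 1)$ equal to
  $\frac{|k|}{2}(1 - 1/\rho) \le \frac{|k|}{2} \ln\rho$, so only half of the gain $\rho^{-|k|}$ is lost.
  The other half, $\rho^{-|k|/2}$, is bounded through the fourth term of the binomial expansion of
  $(1 + |k|/x)^{|k|}$. One choice of $\rho$ serves both the Gaussian range $|k| \lesssim x$ and the
  range $|k| \gg x$, where $I_k(x)$ is much smaller.
\<close>

lemma scaled_bessel_le_power4:
  fixes x :: real and k :: int
  assumes x: "x > 0" and k: "\<bar>k\<bar> \<ge> 4"
  shows "\<bar>scaled_bessel k x\<bar> \<le> 16 * x\<^sup>2 / of_int k ^ 4"
proof -
  define \<kappa> where "\<kappa> = nat \<bar>k\<bar>"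
  have \<kappa>: "\<kappa> \<ge> 4" and k4: "(of_int k :: real) ^ 4 = real \<kappa> ^ 4"
    using k by (auto simp: \<kappa>_def power_even_abs)
  define \<rho> where "\<rho> = 1 + \<kappa> / x"
  have \<rho>: "\<rho> > 1" "\<rho> > 0" using x \<kappa> by (auto simp: \<rho>_def add_pos_nonneg)
  \<comment> \<open>For negative order the reciprocal radius plays the same part, because $r + 1/r$ is symmetric.\<close>
  have le: "\<rho> ^ \<kappa> * \<bar>scaled_bessel k x\<bar> \<le> exp (x * ((\<rho> + 1 / \<rho>) / 2 - 1))"
  proof (cases "k \<ge> 0")
    case True
    hence "\<rho> powi k = \<rho> ^ \<kappa>" by (simp add: \<kappa>_def power_int_def)
    thus ?thesis using scaled_bessel_le[OF x \<rho>(2), of k] by simp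
  next
    case False
    hence "(1 / \<rho>) powi k = \<rho> ^ \<kappa>" by (simp add: \<kappa>_def power_int_def)
    moreover have "1 / \<rho> + 1 / (1 / \<rho>) = \<rho> + 1 / \<rho>" by simp
    ultimately show ?thesis using scaled_bessel_le[OF x, of "1 / \<rho>" k] \<rho>(2) by (simp add: add.commute)
  qed
  have "x * ((\<rho> + 1 / \<rho>) / 2 - 1) = \<kappa> / 2 * (1 - 1 / \<rho>)"
  proof -
    have "x * ((\<rho> + 1 / \<rho>) / 2 - 1) = x * (\<rho> - 1) / 2 * (1 - 1 / \<rho>)"
      using \<rho>(2) by (simp add: field_simps)
    also have "x * (\<rho> - 1) = \<kappa>" using x by (simp add: \<rho>_def)
    finally show ?thesis .
  qed
  also have "\<dots> \<le> \<kappa> / 2 * ln \<rho>"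
  proof (rule mult_left_mono)
    show "1 - 1 / \<rho> \<le> ln \<rho>"
      using ln_le_minus_one[of "1 / \<rho>"] \<rho>(2) by (simp add: ln_div)
  qed simp
  finally have "\<rho> ^ \<kappa> * \<bar>scaled_bessel k x\<bar> \<le> exp (\<kappa> / 2 * ln \<rho>)"
    using le by (meson exp_le_cancel_iff order_trans)
  \<comment> \<open>Squaring keeps all powers of $\rho$ integral when $|k|$ is odd.\<close>
  hence "(\<rho> ^ \<kappa> * \<bar>scaled_bessel k x\<bar>)\<^sup>2 \<le> exp (\<kappa> / 2 * ln \<rho>) ^ 2"
    using \<rho> by (intro power_mono) auto
  also have "\<dots> = \<rho> ^ \<kappa>"
    using exp_of_nat_mult[of \<kappa> "ln \<rho>"] \<rho> by (simp add: power2_eq_square flip: exp_add)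
  finally have "\<rho> ^ \<kappa> * (\<rho> ^ \<kappa> * (scaled_bessel k x)\<^sup>2) \<le> \<rho> ^ \<kappa> * 1"
    by (simp add: power2_eq_square mult_ac)
  hence sq: "\<rho> ^ \<kappa> * (scaled_bessel k x)\<^sup>2 \<le> 1"
    using \<rho> by (subst (asm) mult_le_cancel_left_pos) auto
  have "(real \<kappa> ^ 4 / (16 * x\<^sup>2))\<^sup>2 = (\<kappa> / 4) ^ 4 * (\<kappa> / x) ^ 4"
    by (simp add: power_divide power2_eq_square eval_nat_numeral)
  also have "\<dots> \<le> (\<kappa> choose 4) * (\<kappa> / x) ^ 4"
    using binomial_ge_n_over_k_pow_k[OF \<kappa>, where 'a = real] x by (intro mult_right_mono) auto
  also have "\<dots> \<le> (\<Sum>i\<le>\<kappa>. (\<kappa> choose i) * (\<kappa> / x) ^ i * 1 ^ (\<kappa> - i))"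
    using \<kappa> x by (intro order_trans[OF _ member_le_sum[of 4]]) auto
  also have "\<dots> = \<rho> ^ \<kappa>"
    unfolding \<rho>_def by (subst add.commute, subst binomial_ring) simp
  finally have "(real \<kappa> ^ 4 / (16 * x\<^sup>2))\<^sup>2 * (scaled_bessel k x)\<^sup>2 \<le> 1"
    using sq by (meson mult_right_mono order_trans zero_le_power2)
  hence "(real \<kappa> ^ 4 / (16 * x\<^sup>2) * \<bar>scaled_bessel k x\<bar>)\<^sup>2 \<le> 1\<^sup>2"
    by (simp only: power_mult_distrib power2_abs one_power2)
  hence "real \<kappa> ^ 4 / (16 * x\<^sup>2) * \<bar>scaled_bessel k x\<bar> \<le> 1"
    by (rule power2_le_imp_le) simp
  thus ?thesis using x \<kappa> by (simp add: k4 field_simps)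
qed

section \<open>The local central limit theorem\<close>

text \<open>
  The Fourier transform of the scaled Bessel functions: the symbol $e^{-x(1 - \cos\theta)}$,
  cut off to one period, in the variable $\varphi = \sqrt{x}\,\theta$ in which it tends to a Gaussian.
\<close>

definition rescaled_symbol :: "real \<Rightarrow> real \<Rightarrow> real" where
  "rescaled_symbol x \<phi> = indicator {-pi..pi} (\<phi> / sqrt x) * exp (- (x * (1 - cos (\<phi> / sqrt x))))"

lemma borel_measurable_rescaled_symbol [measurable]: "rescaled_symbol x \<in> borel_measurable borel"
  unfolding rescaled_symbol_def[abs_def] by measurable

lemma rescaled_symbol_nonneg: "rescaled_symbol x \<phi> \<ge> 0"
  by (simp add: rescaled_symbol_def)

lemma rescaled_symbol_le:
  assumes "x > 0"
  shows "rescaled_symbol x \<phi> \<le> exp (- (1 / 12 * \<phi>\<^sup>2))"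
proof (cases "\<bar>\<phi> / sqrt x\<bar> \<le> pi")
  case True
  have "x * ((\<phi> / sqrt x)\<^sup>2 / 12) \<le> x * (1 - cos (\<phi> / sqrt x))"
    using one_minus_cos_ge[OF True] assms by (intro mult_left_mono) auto
  thus ?thesis using assms True by (simp add: rescaled_symbol_def power_divide split: split_indicator)
next
  case False
  hence "\<phi> / sqrt x \<notin> {-pi..pi}" by auto
  thus ?thesis by (simp add: rescaled_symbol_def)
qed

lemma integrable_rescaled_symbol:
  assumes "x > 0"
  shows "integrable lborel (rescaled_symbol x)"
  by (rule Bochner_Integration.integrable_bound[OF gaussian_integral(1)[of "1/12"]])
     (use rescaled_symbol_le[OF assms] rescaled_symbol_nonneg in auto)

lemma scaled_bessel_fourier:
  fixes x :: real and k :: int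
  assumes x: "x > 0"
  shows "(CLINT \<phi>|lborel. rescaled_symbol x \<phi> * cis (- (of_int k / sqrt x) * \<phi>))
           = 2 * pi * complex_of_real (scaled_bessel k x)"
proof -
  have cos_eq: "x / 2 * (complex_of_real 1 * cis \<theta> + cis (- \<theta>) / complex_of_real 1)
                  = of_real (x * cos \<theta>)" for \<theta>
    by (simp add: complex_eq_iff)
  have "2 * pi * complex_of_real (bessel_I k x)
      = (LINT \<theta>|circle_measure. cis (- of_int k * \<theta>) * of_real (exp (x * cos \<theta>)))"
    using bessel_I_integral_rep[OF x zero_less_one, of k, unfolded cos_eq]
    by (simp only: exp_of_real) simp
  also have "\<dots> = (CLINT \<theta>|lborel. indicator {-pi..pi} \<theta> *\<^sub>R (cis (- of_int k * \<theta>) * of_real (exp (x * cos \<theta>))))"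
    by (simp add: integral_circle_measure set_lebesgue_integral_def)
  also have "\<dots> = (1 / sqrt x) *\<^sub>R (CLINT \<phi>|lborel. indicator {-pi..pi} (\<phi> / sqrt x) *\<^sub>R 
       (cis (- of_int k * (\<phi> / sqrt x)) * of_real (exp (x * cos (\<phi> / sqrt x)))))"
    using x by (subst lborel_integral_real_affine[where c = "1 / sqrt x" and t = 0]) simp_all
  finally have "2 * pi * complex_of_real (scaled_bessel k x) = exp (-x) * 
     (CLINT \<phi>|lborel. indicator {-pi..pi} (\<phi> / sqrt x) *\<^sub>R 
       (cis (- of_int k * (\<phi> / sqrt x)) * of_real (exp (x * cos (\<phi> / sqrt x)))))"
    using x by (simp add: scaled_bessel_def scaleR_conv_of_real field_simps)
  also have "\<dots> = (CLINT \<phi>|lborel. exp (-x) * (indicator {-pi..pi} (\<phi> / sqrt x) *\<^sub>R 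
       (cis (- of_int k * (\<phi> / sqrt x)) * of_real (exp (x * cos (\<phi> / sqrt x))))))"
    by (rule Bochner_Integration.integral_mult_right_zero [symmetric])
  also have "\<dots> = (CLINT \<phi>|lborel. rescaled_symbol x \<phi> * cis (- (of_int k / sqrt x) * \<phi>))"
  proof (rule Bochner_Integration.integral_cong)
    fix \<phi> :: real
    have "complex_of_real (exp (- (x * (1 - cos (\<phi> / sqrt x))))) 
            = of_real (exp (-x)) * of_real (exp (x * cos (\<phi> / sqrt x)))"
      by (simp only: flip: of_real_mult exp_add) (simp add: algebra_simps)
    thus "complex_of_real (exp (-x)) * (indicator {-pi..pi} (\<phi> / sqrt x) *\<^sub>R 
       (cis (- of_int k * (\<phi> / sqrt x)) * of_real (exp (x * cos (\<phi> / sqrt x)))))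
       = rescaled_symbol x \<phi> * cis (- (of_int k / sqrt x) * \<phi>)"
      by (simp add: rescaled_symbol_def scaleR_conv_of_real of_real_indicator mult_ac)
  qed simp
  finally show ?thesis by simp
qed

text \<open>
  This is the characteristic function of the standard normal distribution, written without the
  normalisation.
\<close>

lemma gaussian_fourier:
  fixes y :: real
  shows "(CLINT \<phi>|lborel. complex_of_real (exp (- (1 / 2 * \<phi>\<^sup>2))) * cis (- y * \<phi>))
           = of_real (sqrt (2 * pi) * exp (- y\<^sup>2 / 2))"
proof -
  have "of_real (exp (- y\<^sup>2 / 2)) = char std_normal_distribution (-y)"
    by (simp add: char_std_normal_distribution)
  also have "\<dots> = (CLINT \<phi>|lborel. std_normal_density \<phi> *\<^sub>R iexp (-y * \<phi>))"
    unfolding char_def by (subst integral_density) (auto simp: normal_density_nonneg)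
  also have "\<dots> = (CLINT \<phi>|lborel. (1 / sqrt (2 * pi)) *\<^sub>R (complex_of_real (exp (- (1 / 2 * \<phi>\<^sup>2))) * cis (- y * \<phi>)))"
    by (intro Bochner_Integration.integral_cong refl)
       (simp add: std_normal_density_def scaleR_conv_of_real cis_conv_exp mult_ac)
  also have "\<dots> = (1 / sqrt (2 * pi)) *\<^sub>R (CLINT \<phi>|lborel. (complex_of_real (exp (- (1 / 2 * \<phi>\<^sup>2))) * cis (- y * \<phi>)))"
    by simp
  finally show ?thesis by (simp add: scaleR_conv_of_real field_simps)
qed

text \<open>
  The $L^1$ distance of the two Fourier transforms bounds the difference of the functions
  themselves at all points at once; this is where the uniformity in $k$ comes from.
\<close>

definition local_limit_error :: "real \<Rightarrow> real" where
  "local_limit_error x = (LBINT \<phi>. \<bar>rescaled_symbol x \<phi> - exp (- (1 / 2 * \<phi>\<^sup>2))\<bar>) / (2 * pi)"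

text \<open>
  The local central limit theorem for $e^{-x} I_k(x)$, which is the law at time $x$ of the
  simple random walk on the integers with unit jump rate.
\<close>

lemma local_limit:
  fixes x :: real and k :: int
  assumes x: "x > 0"
  shows "\<bar>scaled_bessel k x - exp (- (of_int k)\<^sup>2 / (2 * x)) / sqrt (2 * pi)\<bar> \<le> local_limit_error x"
proof -
  define y where "y = of_int k / sqrt x"
  have int1: "integrable lborel (\<lambda>\<phi>. complex_of_real (rescaled_symbol x \<phi>) * cis (- y * \<phi>))"
    by (rule Bochner_Integration.integrable_bound[OF integrable_rescaled_symbol[OF x]])
       (auto simp: norm_mult cis_conv_exp)
  have int2: "integrable lborel (\<lambda>\<phi>. complex_of_real (exp (- (1 / 2 * \<phi>\<^sup>2))) * cis (- y * \<phi>))"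
    by (rule Bochner_Integration.integrable_bound[OF gaussian_integral(1)[of "1/2"]])
       (auto simp: norm_mult cis_conv_exp)
  have sq: "y\<^sup>2 = (of_int k)\<^sup>2 / x" using x by (simp add: y_def power_divide)
  define g where "g = exp (- (of_int k)\<^sup>2 / (2 * x)) / sqrt (2 * pi)"
  have g: "sqrt (2 * pi) * exp (- y\<^sup>2 / 2) = 2 * pi * g"
    unfolding sq g_def by (simp add: field_simps)
  have "2 * pi * complex_of_real (scaled_bessel k x) - of_real (sqrt (2 * pi) * exp (- y\<^sup>2 / 2))
          = of_real (2 * pi * (scaled_bessel k x - g))"
    unfolding g by (simp add: algebra_simps)
  hence "2 * pi * \<bar>scaled_bessel k x - g\<bar>
          = norm (2 * pi * complex_of_real (scaled_bessel k x) - of_real (sqrt (2 * pi) * exp (- y\<^sup>2 / 2)))"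
    by (simp only: norm_of_real abs_mult) simp
  also have "\<dots> = norm (CLINT \<phi>|lborel. complex_of_real (rescaled_symbol x \<phi>) * cis (- y * \<phi>)
                    - complex_of_real (exp (- (1 / 2 * \<phi>\<^sup>2))) * cis (- y * \<phi>))"
    using Bochner_Integration.integral_diff[OF int1 int2] scaled_bessel_fourier[OF x, of k] gaussian_fourier[of y]
    by (simp only: y_def)
  also have "\<dots> \<le> (LBINT \<phi>. norm (complex_of_real (rescaled_symbol x \<phi>) * cis (- y * \<phi>)
                    - complex_of_real (exp (- (1 / 2 * \<phi>\<^sup>2))) * cis (- y * \<phi>)))"
    by (rule integral_norm_bound)
  also have "\<dots> = 2 * pi * local_limit_error x"
    by (simp add: local_limit_error_def norm_mult flip: left_diff_distrib of_real_diff)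
  finally show ?thesis by (simp add: g_def)
qed

lemma rescaled_symbol_tendsto:
  "((\<lambda>x. rescaled_symbol x \<phi>) \<longlongrightarrow> exp (- (1 / 2 * \<phi>\<^sup>2))) at_top"
proof -
  have "((\<lambda>x. x * (1 - cos (\<bar>\<phi>\<bar> / sqrt x))) \<longlongrightarrow> 1 / 2 * \<bar>\<phi>\<bar>\<^sup>2) at_top"
  proof (cases "\<phi> = 0")
    case False
    define c where "c = \<bar>\<phi>\<bar>"
    have "c > 0" using False by (simp add: c_def)
    hence "((\<lambda>x. x * (1 - cos (c / sqrt x))) \<longlongrightarrow> 1 / 2 * c\<^sup>2) at_top"
      by (real_asymp simp: power2_eq_square)
    thus ?thesis by (simp add: c_def)
  qed simp
  moreover have "cos (\<bar>\<phi>\<bar> / sqrt x) = cos (\<phi> / sqrt x)" for x by (simp add: abs_if)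
  ultimately have "((\<lambda>x. x * (1 - cos (\<phi> / sqrt x))) \<longlongrightarrow> 1 / 2 * \<phi>\<^sup>2) at_top"
    by simp
  hence "((\<lambda>x. exp (- (x * (1 - cos (\<phi> / sqrt x))))) \<longlongrightarrow> exp (- (1 / 2 * \<phi>\<^sup>2))) at_top"
    by (intro tendsto_exp tendsto_minus)
  moreover have "eventually (\<lambda>x. exp (- (x * (1 - cos (\<phi> / sqrt x)))) = rescaled_symbol x \<phi>) at_top"
    using eventually_gt_at_top[of "(\<phi> / pi)\<^sup>2"]
  proof eventually_elim
    case (elim x)
    have "\<bar>\<phi> / pi\<bar> \<le> sqrt x" using elim by (intro real_le_rsqrt) (auto simp: power_divide)
    hence "\<bar>\<phi>\<bar> \<le> pi * sqrt x" by (simp add: field_simps)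
    moreover have "sqrt x > 0"
      using le_less_trans[OF zero_le_power2 elim] by simp
    ultimately have "\<bar>\<phi> / sqrt x\<bar> \<le> pi"
      by (simp only: abs_divide abs_of_pos pos_divide_le_eq)
    hence "\<phi> / sqrt x \<in> {-pi..pi}"
      unfolding abs_le_iff atLeastAtMost_iff using minus_le_iff[of "\<phi> / sqrt x" pi] by blast
    thus ?case by (simp add: rescaled_symbol_def)
  qed
  ultimately show ?thesis by (rule Lim_transform_eventually)
qed

text \<open>
  Dominated convergence; the quadratic lower bound on $1 - \cos$ supplies the Gaussian majorant.
\<close>

lemma local_limit_error_tendsto: "(local_limit_error \<longlongrightarrow> 0) at_top"
proof -
  have "((\<lambda>x. LBINT \<phi>. \<bar>rescaled_symbol x \<phi> - exp (- (1 / 2 * \<phi>\<^sup>2))\<bar>) \<longlongrightarrow> (LBINT (\<phi>::real). 0)) at_top"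
  proof (rule integral_dominated_convergence_at_top)
    show "integrable lborel (\<lambda>\<phi>::real. exp (- (1 / 12 * \<phi>\<^sup>2)) + exp (- (1 / 2 * \<phi>\<^sup>2)))"
      by (intro Bochner_Integration.integrable_add gaussian_integral) auto
    show "AE \<phi> in lborel. ((\<lambda>x. \<bar>rescaled_symbol x \<phi> - exp (- (1 / 2 * \<phi>\<^sup>2))\<bar>) \<longlongrightarrow> 0) at_top"
      using tendsto_rabs_zero[OF LIM_zero[OF rescaled_symbol_tendsto]] by auto
    show "\<forall>\<^sub>F x in at_top. AE \<phi> in lborel. norm \<bar>rescaled_symbol x \<phi> - exp (- (1 / 2 * \<phi>\<^sup>2))\<bar>
            \<le> exp (- (1 / 12 * \<phi>\<^sup>2)) + exp (- (1 / 2 * \<phi>\<^sup>2))"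
      using eventually_gt_at_top[of 0]
    proof eventually_elim
      case (elim x)
      show ?case
      proof (rule AE_I2)
        fix \<phi> :: real
        show "norm \<bar>rescaled_symbol x \<phi> - exp (- (1 / 2 * \<phi>\<^sup>2))\<bar>
            \<le> exp (- (1 / 12 * \<phi>\<^sup>2)) + exp (- (1 / 2 * \<phi>\<^sup>2))"
          using rescaled_symbol_le[OF elim, of \<phi>] rescaled_symbol_nonneg[of x \<phi>]
            exp_gt_zero[of "- (1 / 2 * \<phi>\<^sup>2)"] exp_gt_zero[of "- (1 / 12 * \<phi>\<^sup>2)"]
          unfolding real_norm_def abs_abs by (simp only: abs_le_iff) linarith
      qed
    qed
  qed auto
  hence "((\<lambda>x. (LBINT \<phi>. \<bar>rescaled_symbol x \<phi> - exp (- (1 / 2 * \<phi>\<^sup>2))\<bar>) / (2 * pi)) \<longlongrightarrow> 0 / (2 * pi)) at_top"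
    by (intro tendsto_divide tendsto_const) auto
  thus ?thesis by (simp add: local_limit_error_def[abs_def])
qed

section \<open>The heat kernel under parabolic scaling\<close>

lemma borel_measurable_bessel_I [measurable]: "bessel_I k \<in> borel_measurable borel"
proof -
  have [measurable]: "(\<lambda>x::real. x powi j) \<in> borel_measurable borel" for j
    unfolding power_int_def by (cases "j \<ge> 0") auto
  show ?thesis unfolding bessel_I_def[abs_def] by measurable
qed

lemma borel_measurable_heat_kernel [measurable]: "heat_kernel m \<in> borel_measurable borel"
  unfolding heat_kernel_def[abs_def] by measurable

lemma heat_kernel_eq_scaled_bessel:
  assumes "t > 0"
  shows "heat_kernel m t = scaled_bessel (fst m) (2 * t) * scaled_bessel (snd m) (2 * t) / (2 * t)"
proof -
  have "scaled_bessel (fst m) (2 * t) * scaled_bessel (snd m) (2 * t) =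
          (sqrt (2 * t) * sqrt (2 * t)) * (exp (- (2 * t)) * exp (- (2 * t))) *
          bessel_I (fst m) (2 * t) * bessel_I (snd m) (2 * t)"
    by (simp only: scaled_bessel_def mult_ac)
  also have "exp (- (2 * t)) * exp (- (2 * t)) = exp (- 4 * t)"
    by (simp flip: exp_add)
  also have "sqrt (2 * t) * sqrt (2 * t) = 2 * t" using assms by simp
  finally have "scaled_bessel (fst m) (2 * t) * scaled_bessel (snd m) (2 * t) = 2 * t * heat_kernel m t"
    by (simp add: heat_kernel_def)
  thus ?thesis using assms by (simp add: field_simps)
qed

lemma norm2_squared: "norm2 m ^ 2 = (of_int (fst m))\<^sup>2 + (of_int (snd m))\<^sup>2"
  by (simp add: norm2_def)

lemma abs_heat_kernel_le:
  assumes "t > 0"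
  shows "\<bar>heat_kernel m t\<bar> \<le> 1 / (2 * t)"
proof -
  have "\<bar>scaled_bessel (fst m) (2 * t)\<bar> * \<bar>scaled_bessel (snd m) (2 * t)\<bar> \<le> 1 * 1"
    using assms by (intro mult_mono scaled_bessel_le_1) auto
  thus ?thesis using assms by (simp add: heat_kernel_eq_scaled_bessel abs_mult divide_right_mono)
qed

text \<open>
  The coordinate with the larger modulus, which satisfies $2k^2 \ge \|m\|_2^2$, provides all of the
  decay; the scaled Bessel function of the other coordinate is bounded by $1$. The requirement
  $\|m\|_2 \ge 6$ guarantees $|k| \ge 4$.
\<close>

lemma abs_heat_kernel_le_norm2:
  assumes t: "t > 0" and m: "norm2 m \<ge> 6"
  shows "\<bar>heat_kernel m t\<bar> \<le> 128 * t / norm2 m ^ 4"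
proof -
  define b where "b = (\<lambda>k. \<bar>scaled_bessel k (2 * t)\<bar>)"
  have b1: "0 \<le> b k" "b k \<le> 1" for k
    using scaled_bessel_le_1[of "2 * t" k] t by (auto simp: b_def)
  obtain k where k: "2 * (real_of_int k)\<^sup>2 \<ge> norm2 m ^ 2" "b (fst m) * b (snd m) \<le> b k"
  proof (cases "(real_of_int (fst m))\<^sup>2 \<ge> (real_of_int (snd m))\<^sup>2")
    case True
    have "b (fst m) * b (snd m) \<le> b (fst m)" using b1 by (simp add: mult_left_le)
    with True show ?thesis by (intro that[of "fst m"]) (auto simp: norm2_squared)
  next
    case False
    have "b (fst m) * b (snd m) \<le> b (snd m)" using b1 by (simp add: mult_left_le_one_le)
    with False show ?thesis by (intro that[of "snd m"]) (auto simp: norm2_squared)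
  qed
  have "6\<^sup>2 \<le> norm2 m ^ 2" using m by (intro power_mono) auto
  hence "(4::real)\<^sup>2 \<le> (real_of_int k)\<^sup>2" using k(1) by simp
  hence "\<bar>4::real\<bar> \<le> \<bar>real_of_int k\<bar>" by (simp only: abs_le_square_iff)
  hence k4: "\<bar>k\<bar> \<ge> 4" by linarith
  have "norm2 m ^ 4 = (norm2 m ^ 2)\<^sup>2" by simp
  also have "\<dots> \<le> (2 * (real_of_int k)\<^sup>2)\<^sup>2" using k(1) by (intro power_mono) auto
  also have "\<dots> = 4 * (real_of_int k) ^ 4" by (simp add: power_mult_distrib)
  finally have N: "norm2 m ^ 4 \<le> 4 * (real_of_int k) ^ 4" .
  have "\<bar>heat_kernel m t\<bar> = b (fst m) * b (snd m) / (2 * t)"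
    using t by (simp add: heat_kernel_eq_scaled_bessel abs_mult b_def)
  also have "\<dots> \<le> (16 * (2 * t)\<^sup>2 / real_of_int k ^ 4) / (2 * t)"
    using scaled_bessel_le_power4[of "2 * t" k] k4 k(2) t
    by (intro divide_right_mono) (auto simp: b_def)
  also have "\<dots> = 128 * t / (4 * real_of_int k ^ 4)"
    using t by (simp add: power2_eq_square field_simps)
  also have "\<dots> \<le> 128 * t / norm2 m ^ 4"
    using t m N by (intro divide_left_mono mult_pos_pos) auto
  finally show ?thesis .
qed

text \<open>
  At time $\|m\|_2^2 u$ the two Gaussians of the local limit theorem multiply to a function of
  $m_1^2 + m_2^2 = \|m\|_2^2$ alone. The limit is the heat kernel of the plane at distance $1$ and time
  $u$.
\<close>

lemma heat_kernel_rescaled_limit: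
  fixes m :: "nat \<Rightarrow> int \<times> int" and u :: real
  assumes m: "filterlim (\<lambda>n. norm2 (m n)) at_top sequentially" and u: "u > 0"
  shows "(\<lambda>n. norm2 (m n) ^ 2 * heat_kernel (m n) (norm2 (m n) ^ 2 * u))
           \<longlonglongrightarrow> exp (- 1 / (4 * u)) / (4 * pi * u)"
proof -
  define x where "x = (\<lambda>n. 2 * (norm2 (m n) ^ 2 * u))"
  have x_lim: "filterlim x at_top sequentially"
    unfolding x_def
    by (intro filterlim_tendsto_pos_mult_at_top[OF tendsto_const]
          filterlim_at_top_mult_tendsto_pos[OF tendsto_const] filterlim_pow_at_top m) (use u in auto)
  have err: "(\<lambda>n. local_limit_error (x n)) \<longlonglongrightarrow> 0"
    by (rule filterlim_compose[OF local_limit_error_tendsto x_lim])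
  have pos: "eventually (\<lambda>n. norm2 (m n) > 0) sequentially"
    using m by (simp add: filterlim_at_top_dense)
  define g where "g = (\<lambda>k n. exp (- (real_of_int k)\<^sup>2 / (2 * x n)) / sqrt (2 * pi))"
  have g_le: "norm (g k n) \<le> 1" for k n
  proof -
    have "exp (- (real_of_int k)\<^sup>2 / (2 * x n)) \<le> 1"
      using u by (simp add: x_def)
    also have "1 \<le> sqrt (2 * pi)" using pi_gt3 by simp
    finally show ?thesis by (simp add: g_def divide_le_eq)
  qed
  have approx: "(\<lambda>n. scaled_bessel (p (m n)) (x n) - g (p (m n)) n) \<longlonglongrightarrow> 0"
    for p :: "int \<times> int \<Rightarrow> int"
  proof (rule Lim_null_comparison[OF _ err])
    show "\<forall>\<^sub>F n in sequentially. norm (scaled_bessel (p (m n)) (x n) - g (p (m n)) n) \<le> local_limit_error (x n)"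
      using pos
    proof eventually_elim
      case (elim n)
      thus ?case using local_limit[of "x n" "p (m n)"] u by (simp add: g_def x_def)
    qed
  qed
  \<comment> \<open>$ab - a'b' = (a - a')b + a'(b - b')$ with bounded $a'$ and $b$\<close>
  have "(\<lambda>n. (scaled_bessel (fst (m n)) (x n) - g (fst (m n)) n) * scaled_bessel (snd (m n)) (x n)
          + g (fst (m n)) n * (scaled_bessel (snd (m n)) (x n) - g (snd (m n)) n)) \<longlonglongrightarrow> 0 + 0"
  proof (intro tendsto_add)
    show "(\<lambda>n. (scaled_bessel (fst (m n)) (x n) - g (fst (m n)) n) * scaled_bessel (snd (m n)) (x n)) \<longlonglongrightarrow> 0"
    proof (rule Lim_null_comparison[OF _ tendsto_norm_zero[OF approx[of fst]]])
      show "\<forall>\<^sub>F n in sequentially. norm ((scaled_bessel (fst (m n)) (x n) - g (fst (m n)) n) * scaled_bessel (snd (m n)) (x n))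
               \<le> norm (scaled_bessel (fst (m n)) (x n) - g (fst (m n)) n)"
        using pos
      proof eventually_elim
        case (elim n)
        hence "norm (scaled_bessel (snd (m n)) (x n)) \<le> 1"
          using scaled_bessel_le_1[of "x n"] u by (simp add: x_def)
        thus ?case by (simp only: norm_mult) (intro mult_left_le, auto)
      qed
    qed
    show "(\<lambda>n. g (fst (m n)) n * (scaled_bessel (snd (m n)) (x n) - g (snd (m n)) n)) \<longlonglongrightarrow> 0"
    proof (rule Lim_null_comparison[OF always_eventually tendsto_norm_zero[OF approx[of snd]]])
      show "\<forall>n. norm (g (fst (m n)) n * (scaled_bessel (snd (m n)) (x n) - g (snd (m n)) n))
               \<le> norm (scaled_bessel (snd (m n)) (x n) - g (snd (m n)) n)"
        unfolding norm_mult by (intro allI mult_left_le_one_le g_le norm_ge_zero)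
    qed
  qed
  hence diff: "(\<lambda>n. scaled_bessel (fst (m n)) (x n) * scaled_bessel (snd (m n)) (x n)
          - g (fst (m n)) n * g (snd (m n)) n) \<longlonglongrightarrow> 0"
    by (simp add: algebra_simps)
  have "eventually (\<lambda>n. g (fst (m n)) n * g (snd (m n)) n = exp (- 1 / (4 * u)) / (2 * pi)) sequentially"
    using pos
  proof eventually_elim
    case (elim n)
    have "g (fst (m n)) n * g (snd (m n)) n
            = exp (- ((real_of_int (fst (m n)))\<^sup>2 + (real_of_int (snd (m n)))\<^sup>2) / (2 * x n)) / (2 * pi)"
      by (simp add: g_def diff_divide_distrib flip: exp_add)
    also have "(real_of_int (fst (m n)))\<^sup>2 + (real_of_int (snd (m n)))\<^sup>2 = norm2 (m n) ^ 2"
      by (simp add: norm2_squared)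
    also have "- (norm2 (m n) ^ 2) / (2 * x n) = - 1 / (4 * u)"
      using elim u by (simp add: x_def)
    finally show ?case .
  qed
  hence "(\<lambda>n. g (fst (m n)) n * g (snd (m n)) n) \<longlonglongrightarrow> exp (- 1 / (4 * u)) / (2 * pi)"
    by (rule tendsto_eventually)
  from tendsto_add[OF diff this]
  have "(\<lambda>n. scaled_bessel (fst (m n)) (x n) * scaled_bessel (snd (m n)) (x n) / (2 * u))
          \<longlonglongrightarrow> exp (- 1 / (4 * u)) / (2 * pi) / (2 * u)"
    using u by (intro tendsto_divide tendsto_const) simp_all
  moreover have "eventually (\<lambda>n. scaled_bessel (fst (m n)) (x n) * scaled_bessel (snd (m n)) (x n) / (2 * u)
      = norm2 (m n) ^ 2 * heat_kernel (m n) (norm2 (m n) ^ 2 * u)) sequentially"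
    using pos
  proof eventually_elim
    case (elim n)
    thus ?case using u by (simp add: heat_kernel_eq_scaled_bessel x_def)
  qed
  ultimately have "(\<lambda>n. norm2 (m n) ^ 2 * heat_kernel (m n) (norm2 (m n) ^ 2 * u))
     \<longlonglongrightarrow> exp (- 1 / (4 * u)) / (2 * pi) / (2 * u)"
    by (rule Lim_transform_eventually)
  thus ?thesis by (simp add: mult.assoc)
qed

section \<open>The scaling limit of the kernel\<close>

lemma set_integrable_lborel_nonneg:
  fixes f :: "real \<Rightarrow> real"
  assumes [measurable]: "f \<in> borel_measurable borel" "S \<in> sets borel"
    and f: "f integrable_on S" and nonneg: "\<And>x. x \<in> S \<Longrightarrow> f x \<ge> 0"
  shows "set_integrable lborel S f"
proof -
  have "f absolutely_integrable_on S"
    by (rule nonnegative_absolutely_integrable_1[OF f nonneg])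
  thus ?thesis unfolding set_integrable_def by (subst (asm) integrable_completion) auto
qed

text \<open>
  The majorant is $128\,u$ for $u \le 1$ and $1/u$ for $u \ge 1$, divided by $u^{1+s}$. Integrability at $0$
  is what requires $s < 1$.
\<close>

lemma integrable_dominating_function:
  fixes s :: real
  assumes "0 < s" "s < 1"
  shows "integrable lborel (\<lambda>u. indicator {0..1} u * (128 * u powr (-s)) + indicator {1..} u * u powr (-2 - s))"
proof (rule Bochner_Integration.integrable_add)
  have "set_integrable lborel {0..1} (\<lambda>u. 128 * u powr (-s))"
    using integrable_on_powr_from_0[of "-s" 1] assms
    by (intro set_integrable_lborel_nonneg integrable_on_mult_right) auto
  thus "integrable lborel (\<lambda>u. indicator {0..1} u * (128 * u powr (-s)))"
    by (simp add: set_integrable_def)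
  have "set_integrable lborel {1..} (\<lambda>u. u powr (-2 - s))"
    using has_integral_powr_to_inf[of "-2 - s" 1] assms
    by (intro set_integrable_lborel_nonneg) (auto simp: integrable_on_def)
  thus "integrable lborel (\<lambda>u. indicator {1..} u * u powr (-2 - s))"
    by (simp add: set_integrable_def)
qed

text \<open>
  The substitution $u = 1/(4v)$ turns the integral of the planar heat kernel at distance $1$ into
  Euler's integral for $\Gamma(1 + s)$.
\<close>

lemma set_integral_heat_kernel_subordination:
  fixes s :: real
  assumes s: "0 < s"
  shows "(LBINT u:{0<..}. exp (- 1 / (4 * u)) / (4 * pi * u) / u powr (1 + s)) = 4 powr s * Gamma (1 + s) / pi"
proof -
  define f where "f = (\<lambda>u::real. exp (- 1 / (4 * u)) / (4 * pi * u) / u powr (1 + s))"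
  have [measurable]: "f \<in> borel_measurable borel" unfolding f_def by measurable
  define g g' where "g = (\<lambda>v::real. 1 / (4 * v))" and "g' = (\<lambda>v::real. - 1 / (4 * v\<^sup>2))"
  have "((\<lambda>t. t powr s / exp t) has_integral Gamma (1 + s)) {0..}"
    using Gamma_integral_real[of "1 + s"] s by simp
  hence "((\<lambda>t. t powr s / exp t) has_integral Gamma (1 + s)) {0<..}"
    by (subst (asm) has_integral_spike_set_eq[where T = "{0<..}"])
       (auto intro: negligible_subset[of "{0}"])
  hence "((\<lambda>v. 4 powr s / pi * (v powr s / exp v)) has_integral 4 powr s / pi * Gamma (1 + s)) {0<..}"
    by (rule has_integral_mult_right)
  moreover have subst: "4 powr s / pi * (v powr s / exp v) = \<bar>g' v\<bar> * f (g v)" if "v \<in> {0<..}" for v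
  proof -
    have v: "v > 0" using that by simp
    have "(1 / (4 * v)) powr (1 + s) = 1 / (4 * v * (4 powr s * v powr s))"
      using v by (simp add: powr_divide powr_add powr_mult)
    thus ?thesis using v
      by (simp add: f_def g_def g'_def exp_minus power2_eq_square field_simps)
  qed
  ultimately have hi: "((\<lambda>v. \<bar>g' v\<bar> * f (g v)) has_integral 4 powr s / pi * Gamma (1 + s)) {0<..}"
    by (subst (asm) has_integral_cong[OF subst])
  hence "(\<lambda>v. \<bar>g' v\<bar> * f (g v)) absolutely_integrable_on {0<..} \<and>
         integral {0<..} (\<lambda>v. \<bar>g' v\<bar> * f (g v)) = 4 powr s / pi * Gamma (1 + s)"
  proof (intro conjI nonnegative_absolutely_integrable_1 integral_unique)
    show "0 \<le> \<bar>g' v\<bar> * f (g v)" if "v \<in> {0<..}" for v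
      using that by (simp flip: subst)
  qed (auto simp: integrable_on_def)
  moreover have "g ` {0<..} = {0<..}"
  proof (intro equalityI subsetI)
    fix u :: real assume "u \<in> {0<..}"
    hence "u = g (1 / (4 * u))" "1 / (4 * u) \<in> {0<..}" by (auto simp: g_def)
    thus "u \<in> g ` {0<..}" by blast
  qed (auto simp: g_def)
  moreover have "(g has_field_derivative g' v) (at v within {0<..})" if "v \<in> {0<..}" for v
    using that unfolding g_def g'_def
    by (auto intro!: derivative_eq_intros simp: power2_eq_square)
  moreover have "inj_on g {0<..}"
    by (auto simp: g_def inj_on_def)
  ultimately have "f absolutely_integrable_on {0<..} \<and> integral {0<..} f = 4 powr s / pi * Gamma (1 + s)"
    using has_absolute_integral_change_of_variables_1'[of "{0<..}" g g' f "4 powr s / pi * Gamma (1 + s)"]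
    by simp
  moreover from this have "set_integrable lborel {0<..} f"
    unfolding set_integrable_def by (subst (asm) integrable_completion) auto
  ultimately show ?thesis
    using set_borel_integral_eq_integral(2)[of "{0<..}" f] by (simp add: f_def)
qed

text \<open>
  Parabolic scaling: the substitution $t = \|m\|_2^2 u$ moves the whole dependence on the size of $m$
  into the rescaled heat kernel.
\<close>

lemma norm2_powr_times_K:
  assumes m: "norm2 m > 0"
  shows "norm2 m powr (2 + 2 * s) * K s m =
    1 / \<bar>Gamma (- s)\<bar> * (LBINT u:{0<..}. norm2 m ^ 2 * heat_kernel m (norm2 m ^ 2 * u) / u powr (1 + s))"
proof -
  define N where "N = norm2 m"
  have N: "N > 0" using m by (simp add: N_def)
  have Np: "(N\<^sup>2 * u) powr (1 + s) = N powr (2 + 2 * s) * u powr (1 + s)" if "u > 0" for u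
  proof -
    have "(N\<^sup>2) powr (1 + s) = (N powr 2) powr (1 + s)" using N by (simp add: powr_numeral)
    also have "\<dots> = N powr (2 + 2 * s)" by (simp add: powr_powr)
    finally show ?thesis using N that by (simp add: powr_mult)
  qed
  have "(LBINT t:{0<..}. heat_kernel m t / t powr (1 + s)) =
        N\<^sup>2 * (LBINT u. indicator {0<..} (N\<^sup>2 * u) * (heat_kernel m (N\<^sup>2 * u) / (N\<^sup>2 * u) powr (1 + s)))"
    unfolding set_lebesgue_integral_def
    using N by (subst lborel_integral_real_affine[where c = "N\<^sup>2" and t = 0]) auto
  hence "N powr (2 + 2 * s) * (LBINT t:{0<..}. heat_kernel m t / t powr (1 + s)) =
        (LBINT u. (N powr (2 + 2 * s) * N\<^sup>2) * (indicator {0<..} (N\<^sup>2 * u) * (heat_kernel m (N\<^sup>2 * u) / (N\<^sup>2 * u) powr (1 + s))))"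
    by (simp only: Bochner_Integration.integral_mult_right_zero mult.assoc)
  also have "\<dots> = (LBINT u:{0<..}. N\<^sup>2 * heat_kernel m (N\<^sup>2 * u) / u powr (1 + s))"
    unfolding set_lebesgue_integral_def
  proof (intro Bochner_Integration.integral_cong refl)
    fix u :: real
    show "N powr (2 + 2 * s) * N\<^sup>2 * (indicator {0<..} (N\<^sup>2 * u) * (heat_kernel m (N\<^sup>2 * u) / (N\<^sup>2 * u) powr (1 + s)))
      = indicator {0<..} u *\<^sub>R (N\<^sup>2 * heat_kernel m (N\<^sup>2 * u) / u powr (1 + s))"
      using N Np[of u] by (cases "u > 0") (simp_all add: zero_less_mult_iff)
  qed
  finally show ?thesis by (simp add: K_def N_def mult.left_commute)
qed

lemma norm2_powr_times_K_tendsto: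
  fixes s :: real and m :: "nat \<Rightarrow> int \<times> int"
  assumes s: "0 < s" "s < 1"
    and m: "filterlim (\<lambda>n. norm2 (m n)) at_top sequentially"
  shows "(\<lambda>n. norm2 (m n) powr (2 + 2 * s) * K s (m n)) \<longlonglongrightarrow> c2 s"
proof -
  define F where "F = (\<lambda>n u. indicator {0<..} u *\<^sub>R
     (norm2 (m n) ^ 2 * heat_kernel (m n) (norm2 (m n) ^ 2 * u) / u powr (1 + s)))"
  define w where "w = (\<lambda>u. indicator {0..1} u * (128 * u powr (-s)) + indicator {1..} u * u powr (-2 - s))"
  have large: "eventually (\<lambda>n. norm2 (m n) \<ge> 6) sequentially"
    using m by (simp add: filterlim_at_top)
  then obtain n0 where n0: "\<And>n. n \<ge> n0 \<Longrightarrow> norm2 (m n) \<ge> 6"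
    by (auto simp: eventually_sequentially)
  have bound: "norm (F (n + n0) u) \<le> w u" for n u
  proof (cases "u > 0")
    case True
    define N where "N = norm2 (m (n + n0))"
    have N: "N \<ge> 6" using n0 by (simp add: N_def)
    define h where "h = \<bar>N\<^sup>2 * heat_kernel (m (n + n0)) (N\<^sup>2 * u)\<bar>"
    \<comment> \<open>two bounds of the rescaled heat kernel, for large and for small $u$\<close>
    have "h \<le> N\<^sup>2 * (1 / (2 * (N\<^sup>2 * u)))"
      unfolding h_def abs_mult using N True by (intro mult_mono abs_heat_kernel_le) auto
    also have "\<dots> = 1 / (2 * u)" using N by simp
    also have "\<dots> \<le> 1 / u" using True by (simp add: field_simps)
    finally have h1: "h \<le> 1 / u" .
    have "h \<le> N\<^sup>2 * (128 * (N\<^sup>2 * u) / N ^ 4)"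
      using abs_heat_kernel_le_norm2[of "N\<^sup>2 * u" "m (n + n0)"] N True
      unfolding h_def abs_mult by (intro mult_mono) (auto simp: N_def)
    also have "\<dots> = 128 * u" using N by (simp add: power2_eq_square power4_eq_xxxx)
    finally have h2: "h \<le> 128 * u" .
    have F: "norm (F (n + n0) u) = h / u powr (1 + s)"
      using True by (simp add: F_def h_def N_def)
    show ?thesis
    proof (cases "u \<le> 1")
      case le: True
      have "h / u powr (1 + s) \<le> 128 * u / u powr (1 + s)"
        using h2 by (intro divide_right_mono) auto
      also have "\<dots> = 128 * u powr (-s)"
        using True by (simp add: powr_add powr_minus field_simps)
      also have "\<dots> \<le> w u" using True le by (simp add: w_def)
      finally show ?thesis by (simp only: F)
    next
      case False
      have "h / u powr (1 + s) \<le> 1 / u / u powr (1 + s)"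
        using h1 by (intro divide_right_mono) auto
      also have "\<dots> = u powr (-2 - s)"
        using True by (simp add: powr_add powr_diff powr_minus power2_eq_square field_simps)
      also have "\<dots> \<le> w u" using False by (simp add: w_def)
      finally show ?thesis by (simp only: F)
    qed
  next
    case False
    thus ?thesis by (simp add: F_def w_def)
  qed
  have "(\<lambda>n. LBINT u. F (n + n0) u) \<longlonglongrightarrow>
     (LBINT u. indicator {0<..} u *\<^sub>R (exp (- 1 / (4 * u)) / (4 * pi * u) / u powr (1 + s)))"
  proof (rule integral_dominated_convergence)
    show "integrable lborel w"
      unfolding w_def by (rule integrable_dominating_function[OF s])
    show "AE u in lborel. norm (F (n + n0) u) \<le> w u" for n
      using bound by simp
    show "F (n + n0) \<in> borel_measurable lborel" for n
      unfolding F_def by measurable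
    show "AE u in lborel. (\<lambda>n. F (n + n0) u) \<longlonglongrightarrow>
            indicator {0<..} u *\<^sub>R (exp (- 1 / (4 * u)) / (4 * pi * u) / u powr (1 + s))"
    proof (intro AE_I2 LIMSEQ_ignore_initial_segment)
      fix u :: real
      show "(\<lambda>n. F n u) \<longlonglongrightarrow> indicator {0<..} u *\<^sub>R (exp (- 1 / (4 * u)) / (4 * pi * u) / u powr (1 + s))"
      proof (cases "u > 0")
        case True
        show ?thesis unfolding F_def
          by (intro tendsto_scaleR tendsto_divide tendsto_const heat_kernel_rescaled_limit[OF m True])
             (use True in auto)
      qed (simp add: F_def)
    qed
  qed measurable
  hence "(\<lambda>n. LBINT u. F n u) \<longlonglongrightarrow> 4 powr s * Gamma (1 + s) / pi"
    using set_integral_heat_kernel_subordination[OF s(1)]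
    by (intro LIMSEQ_offset[of "\<lambda>n. LBINT u. F n u" n0]) (simp add: set_lebesgue_integral_def)
  hence "(\<lambda>n. 1 / \<bar>Gamma (-s)\<bar> * (LBINT u. F n u)) \<longlonglongrightarrow> 1 / \<bar>Gamma (-s)\<bar> * (4 powr s * Gamma (1 + s) / pi)"
    by (intro tendsto_mult tendsto_const)
  moreover have "\<forall>\<^sub>F n in sequentially. 1 / \<bar>Gamma (-s)\<bar> * (LBINT u. F n u) = norm2 (m n) powr (2 + 2 * s) * K s (m n)"
    using large by eventually_elim (simp add: norm2_powr_times_K F_def set_lebesgue_integral_def)
  ultimately have "(\<lambda>n. norm2 (m n) powr (2 + 2 * s) * K s (m n)) \<longlonglongrightarrow> 1 / \<bar>Gamma (-s)\<bar> * (4 powr s * Gamma (1 + s) / pi)"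
    by (rule Lim_transform_eventually)
  thus ?thesis by (simp add: c2_def field_simps)
qed

text \<open>
  Dominated convergence is available along sequences only, which is enough because the filter of
  neighbourhoods of infinity is countably generated.
\<close>

lemma tendsto_norm2_at_infinityI:
  fixes f :: "int \<times> int \<Rightarrow> 'a :: metric_space"
  assumes "\<And>m. filterlim (\<lambda>n::nat. norm2 (m n)) at_top sequentially \<Longrightarrow> (\<lambda>n. f (m n)) \<longlonglongrightarrow> L"
  shows "(f \<longlongrightarrow> L) (filtercomap norm2 at_top)"
proof (rule ccontr)
  assume "\<not> (f \<longlongrightarrow> L) (filtercomap norm2 at_top)"
  then obtain e where e: "e > 0" "\<not> eventually (\<lambda>m. dist (f m) L < e) (filtercomap norm2 at_top)"
    unfolding tendsto_iff by blast
  have "\<exists>m. norm2 m \<ge> real n \<and> \<not> dist (f m) L < e" for n :: nat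
    using e(2) unfolding eventually_filtercomap_at_top_linorder by blast
  then obtain m where m: "\<And>n. norm2 (m n) \<ge> real n" "\<And>n. \<not> dist (f (m n)) L < e"
    by metis
  have "filterlim (\<lambda>n. norm2 (m n)) at_top sequentially"
    using m(1) by (intro filterlim_at_top_mono[OF filterlim_real_sequentially] always_eventually) auto
  from tendstoD[OF assms[OF this] e(1)] m(2) show False
    by (simp add: eventually_sequentially)
qed

lemma both_at_infinity_le: "both_at_infinity \<le> filtercomap norm2 at_top"
  unfolding le_filter_def
proof (intro allI impI)
  fix P assume "eventually P (filtercomap norm2 at_top)"
  then obtain R where R: "\<And>m. norm2 m \<ge> R \<Longrightarrow> P m"
    by (auto simp: eventually_filtercomap_at_top_linorder)
  show "eventually P both_at_infinity"
    unfolding both_at_infinity_def eventually_filtercomap_at_top_linorder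
  proof (intro exI[of _ "\<lceil>R\<rceil>"] allI impI R)
    fix m :: "int \<times> int" assume "\<lceil>R\<rceil> \<le> min \<bar>fst m\<bar> \<bar>snd m\<bar>"
    hence "R \<le> \<bar>real_of_int (fst m)\<bar>" by linarith
    also have "\<dots> \<le> norm2 m"
      unfolding norm2_def by (intro real_le_rsqrt) auto
    finally show "R \<le> norm2 m" .
  qed
qed

text \<open>
  Positivity and the error term both follow from the limit: $c_{2,s}$ is positive because
  $\Gamma(-s) \ne 0$ for $0 < s < 1$.
\<close>

theorem lemma5p1:
  fixes s :: real
  assumes "0 < s" and "s < 1"
  shows "(\<forall>\<^sub>F m in both_at_infinity. 0 < K s m) \<and>
    (\<lambda>m. K s m - c2 s / norm2 m powr (2 + 2 * s))
      \<in> o[both_at_infinity](\<lambda>m. norm2 m powr (- (2 + 2 * s))) \<and>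
    ((\<lambda>m. norm2 m powr (2 + 2 * s) * K s m) \<longlongrightarrow> c2 s) both_at_infinity"
proof -
  have lim: "((\<lambda>m. norm2 m powr (2 + 2 * s) * K s m) \<longlongrightarrow> c2 s) both_at_infinity"
    by (rule tendsto_mono[OF both_at_infinity_le tendsto_norm2_at_infinityI])
       (rule norm2_powr_times_K_tendsto[OF assms])
  have pos: "\<forall>\<^sub>F m in both_at_infinity. norm2 m > 0"
    using both_at_infinity_le filter_leD eventually_filtercomapI[OF eventually_gt_at_top[of 0]] by blast
  have Gamma_ne: "Gamma (-s) \<noteq> 0"
  proof -
    have "-s \<notin> \<int>\<^sub>\<le>\<^sub>0"
    proof
      assume "-s \<in> \<int>\<^sub>\<le>\<^sub>0"
      then obtain n where "- s = of_int n" by (auto elim!: nonpos_Ints_cases)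
      hence "real_of_int (-1) < of_int n" "real_of_int n < of_int 0" using assms by auto
      thus False by (simp only: of_int_less_iff)
    qed
    thus ?thesis by (simp add: Gamma_eq_zero_iff)
  qed
  hence "c2 s > 0"
    using assms Gamma_real_pos[of "1 + s"] by (simp add: c2_def)
  from order_tendstoD(1)[OF lim this]
  have "\<forall>\<^sub>F m in both_at_infinity. 0 < K s m"
    by eventually_elim (simp add: zero_less_mult_iff)
  moreover have "(\<lambda>m. K s m - c2 s / norm2 m powr (2 + 2 * s))
      \<in> o[both_at_infinity](\<lambda>m. norm2 m powr (- (2 + 2 * s)))"
  proof (rule smalloI_tendsto)
    show "\<forall>\<^sub>F m in both_at_infinity. norm2 m powr (- (2 + 2 * s)) \<noteq> 0"
      using pos by eventually_elim simp
    have "((\<lambda>m. norm2 m powr (2 + 2 * s) * K s m - c2 s) \<longlongrightarrow> 0) both_at_infinity"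
      by (rule LIM_zero[OF lim])
    moreover have "\<forall>\<^sub>F m in both_at_infinity. norm2 m powr (2 + 2 * s) * K s m - c2 s =
       (K s m - c2 s / norm2 m powr (2 + 2 * s)) / norm2 m powr (- (2 + 2 * s))"
      using pos
    proof eventually_elim
      case (elim m)
      define P where "P = norm2 m powr (2 + 2 * s)"
      have P: "P > 0" using elim by (simp add: P_def)
      have powr_eq: "norm2 m powr (- (2 + 2 * s)) = 1 / P"
        unfolding P_def powr_minus by (simp add: divide_inverse)
      show ?case
        unfolding powr_eq P_def [symmetric] using P by (simp add: field_simps)
    qed
    ultimately show "((\<lambda>m. (K s m - c2 s / norm2 m powr (2 + 2 * s)) / norm2 m powr (- (2 + 2 * s))) \<longlongrightarrow> 0) both_at_infinity"
      by (rule Lim_transform_eventually)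
  qed
  ultimately show ?thesis using lim by blast
qed

end
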